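(* Let $a_1(n),a_2(n),m(n)$ be integer-valued quasi-polynomials with positive leading coefficients. If $\mathrm{ggcd}(a_1(n),a_2(n))=1$, then $$p_{\{a_1(n),a_2(n)\}}(m(n))=\frac{m(n)}{a_1(n)a_2(n)}-\bigg\{\frac{a_1(n)^{-1}m(n)}{a_2(n)}\bigg\}-\bigg\{\frac{a_2(n)^{-1}m(n)}{a_1(n)}\bigg\}+1$$ is an integer-valued quasi-polynomial, where $a_1(n)^{-1}$ is an inverse of $a_1(n)$ mod $a_2(n)$ and $a_2(n)^{-1}$ is an inverse of $a_2(n)$ mod $a_1(n)$.
   Context: $\mathbb{N}$ is the set of natural numbers, and $\{y\}=y-[y]$ is the fractional part of a rational number $y$, where $[y]$ is the floor. An integer-valued quasi-polynomial is a function $f:\mathbb{N}\to\mathbb{Z}$ for which there exist positive integers $T,C$ and polynomials $f_i(x)\in\mathbb{Z}[x]$ ($i=0,1,\dots,T-1$) such that $f(n)=f_i(m)$ whenever $n>C$ and $n=Tm+i$ with $m\in\mathbb{N}$. The integer-valued quasi-polynomials form a commutative ring $R$ with identity under pointwise addition and multiplication. Positive leading coefficients means that the leading coefficient of every $f_i$ is positive. Write $f\succcurlyeq 0$ if each $f_i$ is zero or has positive leading coefficient. For $f,g\in R$ with $g(n)\neq0$ for every $n\in\mathbb{N}$, $g$ is a divisor of $f$, written $g\mid f$, if $g(n)$ divides $f(n)$ for every $n\in\mathbb{N}$. For $f_1,\dots,f_s\in R$, $\mathrm{ggcd}(f_1,\dots,f_s)$ is the unique greatest common divisor $d\in R$ with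 $d\succcurlyeq0$; here a greatest common divisor is a $d\in R$ such that $d\mid f_k$ for all $k$ and every $p\in R$ with $p\mid f_k$ for all $k$ satisfies $p\mid d$. If $\mathrm{ggcd}(a_1,a_2)=1$, there exist $u_1,u_2\in R$ with $a_1u_1+a_2u_2=1$; then $u_1$ is called an inverse of $a_1$ mod $a_2$ (denoted $a_1^{-1}$) and $u_2$ an inverse of $a_2$ mod $a_1$ (denoted $a_2^{-1}$). The function $p$ is defined by $p_{\{a_1(n),a_2(n)\}}(m(n))=\#\{(x_1,x_2)\in\mathbb{Z}^2:\text{ all }x_j\ge0,\ x_1a_1(n)+x_2a_2(n)=m(n)\}$.
   Formalization: The displayed identity is asserted only at those n with a_1(n), a_2(n) > 0 and m(n) ≥ 0, which includes all large n; it can fail at the finitely many other n, e.g. a_1 = a_2 = 1, m(n) = n − 5, n = 0. *)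

theory Defs
  imports Complex_Main "HOL-Computational_Algebra.Polynomial"
begin

definition qp_rep :: "(nat \<Rightarrow> int) \<Rightarrow> nat \<Rightarrow> nat \<Rightarrow> (nat \<Rightarrow> int poly) \<Rightarrow> bool" where
  "qp_rep f T C F \<longleftrightarrow> T > 0 \<and> C > 0 \<and>
     (\<forall>k i. i < T \<longrightarrow> T * k + i > C \<longrightarrow> f (T * k + i) = poly (F i) (int k))"

definition quasi_poly :: "(nat \<Rightarrow> int) \<Rightarrow> bool" where
  "quasi_poly f \<longleftrightarrow> (\<exists>T C F. qp_rep f T C F)"

text \<open>In the next two definitions the choice of the representation is immaterial: two
  representations of the same function have a common refinement, and refining
  \<open>F i\<close> to \<open>F i (T' x + j)\<close> preserves the sign of the leading coefficient.\<close>

definition qp_pos :: "(nat \<Rightarrow> int) \<Rightarrow> bool" where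
  "qp_pos f \<longleftrightarrow> (\<exists>T C F. qp_rep f T C F \<and> (\<forall>i<T. lead_coeff (F i) > 0))"

definition qp_nonneg :: "(nat \<Rightarrow> int) \<Rightarrow> bool" where
  "qp_nonneg f \<longleftrightarrow> (\<exists>T C F. qp_rep f T C F \<and> (\<forall>i<T. F i = 0 \<or> lead_coeff (F i) > 0))"

definition qp_dvd :: "(nat \<Rightarrow> int) \<Rightarrow> (nat \<Rightarrow> int) \<Rightarrow> bool" where
  "qp_dvd g f \<longleftrightarrow> quasi_poly g \<and> quasi_poly f \<and> (\<forall>n. g n \<noteq> 0) \<and> (\<forall>n. g n dvd f n)"

definition is_qp_gcd :: "(nat \<Rightarrow> int) \<Rightarrow> (nat \<Rightarrow> int) set \<Rightarrow> bool" where
  "is_qp_gcd d A \<longleftrightarrow> quasi_poly d \<and> (\<forall>f\<in>A. qp_dvd d f) \<and>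
     (\<forall>p. quasi_poly p \<longrightarrow> (\<forall>f\<in>A. qp_dvd p f) \<longrightarrow> qp_dvd p d)"

text \<open>The normalised gcd is a relation rather than a function: \<open>qp_nonneg\<close> only sees the
  values at large arguments, so it determines the gcd only up to signs at finitely many
  arguments.\<close>

definition is_ggcd :: "(nat \<Rightarrow> int) \<Rightarrow> (nat \<Rightarrow> int) set \<Rightarrow> bool" where
  "is_ggcd d A \<longleftrightarrow> is_qp_gcd d A \<and> qp_nonneg d"

definition is_qp_inverse :: "(nat \<Rightarrow> int) \<Rightarrow> (nat \<Rightarrow> int) \<Rightarrow> (nat \<Rightarrow> int) \<Rightarrow> bool" where
  "is_qp_inverse u a b \<longleftrightarrow> quasi_poly u \<and>
     (\<exists>v. quasi_poly v \<and> (\<forall>n. a n * u n + b n * v n = 1))"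

text \<open>The set of solutions can be infinite when \<open>a\<close> or \<open>b\<close> is not positive; the value is
  then \<open>0\<close> by the convention for \<^const>\<open>card\<close>.\<close>

definition num_reps :: "int \<Rightarrow> int \<Rightarrow> int \<Rightarrow> nat" where
  "num_reps a b m =
     card {(x, y). x \<ge> 0 \<and> y \<ge> 0 \<and> x * a + y * b = m}"

end

theory Submission
  imports Defs "HOL-Computational_Algebra.Polynomial_Factorial"
begin

text \<open>On a suitable residue class, \<open>a\<^sub>1\<close> and \<open>a\<^sub>2\<close> are polynomials \<open>h F\<close> and \<open>h G\<close> with \<open>F\<close> and
  \<open>G\<close> coprime, and \<open>gcd (F n) (G n)\<close> is periodic; so the pointwise gcd of \<open>a\<^sub>1\<close> and \<open>a\<^sub>2\<close> is
  itself a quasi-polynomial combination \<open>a\<^sub>1 u + a\<^sub>2 v\<close>, and the hypothesis on the ggcd forces it to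
  be a unit everywhere. The formula for the number of representations holds pointwise, and because
  \<open>a\<^sub>1 u + a\<^sub>2 v = 1\<close> the fractional parts in it combine to
  \<open>\<lfloor>u m / a\<^sub>2\<rfloor> + \<lfloor>v m / a\<^sub>1\<rfloor> + 1\<close>. Floors of quotients of quasi-polynomials are quasi-polynomials,
  by pseudo-division of polynomials.\<close>

section \<open>Large arguments and residue classes\<close>

lemma eventually_residues:
  fixes P :: "nat \<Rightarrow> bool"
  assumes "T > 0" and "\<And>i. i < T \<Longrightarrow> \<forall>\<^sub>F k in sequentially. P (T * k + i)"
  shows "eventually P sequentially"
proof -
  have "\<forall>\<^sub>F k in sequentially. \<forall>i\<in>{..<T}. P (T * k + i)"
    using assms(2) by (intro eventually_ball_finite) auto
  then obtain K where K: "\<And>k i. k \<ge> K \<Longrightarrow> i < T \<Longrightarrow> P (T * k + i)"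
    by (auto simp: eventually_sequentially)
  have "P n" if "n \<ge> T * K" for n
  proof -
    have "n div T \<ge> K"
      using that \<open>T > 0\<close> by (simp add: less_eq_div_iff_mult_less_eq mult.commute)
    from K[OF this, of "n mod T"] \<open>T > 0\<close> show ?thesis by simp
  qed
  then show ?thesis by (auto simp: eventually_sequentially)
qed

lemma eventually_residue:
  assumes "eventually P sequentially" and "T > (0::nat)"
  shows "\<forall>\<^sub>F k in sequentially. P (T * k + i)"
proof -
  obtain N where N: "\<And>n. n \<ge> N \<Longrightarrow> P n"
    using assms(1) by (auto simp: eventually_sequentially)
  have "P (T * k + i)" if "k \<ge> N" for k
  proof (rule N)
    have "k \<le> T * k" using assms(2) by simp
    with that show "N \<le> T * k + i" by linarith
  qed
  then show ?thesis by (auto simp: eventually_sequentially)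
qed

section \<open>Quasi-polynomials as functions eventually polynomial on each residue class\<close>

text \<open>A filter replaces the explicit threshold, so that finitely many exceptional arguments
  need no bookkeeping.\<close>

definition poly_residues :: "nat \<Rightarrow> (nat \<Rightarrow> int) \<Rightarrow> bool" where
  "poly_residues T f \<longleftrightarrow> (\<forall>i<T. \<exists>P. \<forall>\<^sub>F k in sequentially. f (T * k + i) = poly P (int k))"

lemma poly_residuesE:
  assumes "poly_residues T f" and "i < T"
  obtains P where "\<forall>\<^sub>F k in sequentially. f (T * k + i) = poly P (int k)"
  using assms by (auto simp: poly_residues_def)

lemma quasi_poly_iff: "quasi_poly f \<longleftrightarrow> (\<exists>T>0. poly_residues T f)"
proof
  assume "quasi_poly f"
  then obtain T C F where rep: "T > 0"
      "\<And>k i. i < T \<Longrightarrow> T * k + i > C \<Longrightarrow> f (T * k + i) = poly (F i) (int k)"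
    by (auto simp: quasi_poly_def qp_rep_def)
  have "\<forall>\<^sub>F k in sequentially. f (T * k + i) = poly (F i) (int k)" if "i < T" for i
    using eventually_residue[OF eventually_gt_at_top[of C] \<open>T > 0\<close>, of i]
    by eventually_elim (use rep that in auto)
  with \<open>T > 0\<close> show "\<exists>T>0. poly_residues T f"
    unfolding poly_residues_def by blast
next
  assume "\<exists>T>0. poly_residues T f"
  then obtain T where "T > 0" and
      "\<forall>i<T. \<exists>P. \<forall>\<^sub>F k in sequentially. f (T * k + i) = poly P (int k)"
    by (auto simp: poly_residues_def)
  then obtain F where
    F: "\<And>i. i < T \<Longrightarrow> \<forall>\<^sub>F k in sequentially. f (T * k + i) = poly (F i) (int k)"
    by metis
  have "\<forall>\<^sub>F k in sequentially. \<forall>i\<in>{..<T}. f (T * k + i) = poly (F i) (int k)"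
    using F by (intro eventually_ball_finite) auto
  then obtain K where
    K: "\<And>k i. k \<ge> K \<Longrightarrow> i < T \<Longrightarrow> f (T * k + i) = poly (F i) (int k)"
    by (auto simp: eventually_sequentially)
  \<comment> \<open>The successor makes the threshold positive, as \<open>qp_rep\<close> demands;
    beyond \<open>T * K\<close>, the bound \<open>i < T\<close> forces
    \<open>k \<ge> K\<close>.\<close>
  have "f (T * k + i) = poly (F i) (int k)" if "i < T" "T * k + i > Suc (T * K)" for k i
  proof (rule K)
    show "K \<le> k"
    proof (rule ccontr)
      assume "\<not> K \<le> k"
      then have "T * Suc k \<le> T * K" by (intro mult_left_mono) auto
      with that show False by simp
    qed
  qed fact
  then have "qp_rep f T (Suc (T * K)) F"
    using \<open>T > 0\<close> by (simp add: qp_rep_def)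
  then show "quasi_poly f" by (auto simp: quasi_poly_def)
qed

text \<open>A class modulo \<open>T * S\<close> is a class modulo \<open>T\<close> sampled at
  \<open>S * k + j\<close>, so a linear substitution gives its polynomial.\<close>

lemma poly_residues_mult:
  assumes "poly_residues T f" and "S > 0"
  shows "poly_residues (T * S) f"
  unfolding poly_residues_def
proof (intro allI impI)
  fix i assume "i < T * S"
  then have "T > 0" by (cases T) auto
  define r j where "r = i mod T" and "j = i div T"
  have i: "i = T * j + r" and "r < T" using \<open>T > 0\<close> by (auto simp: r_def j_def)
  obtain P where P: "\<forall>\<^sub>F k in sequentially. f (T * k + r) = poly P (int k)"
    using assms(1) \<open>r < T\<close> by (auto simp: poly_residues_def)
  have "\<forall>\<^sub>F k in sequentially. f (T * S * k + i) = poly (pcompose P [:int j, int S:]) (int k)"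
    using eventually_residue[OF P \<open>S > 0\<close>, of j]
    by eventually_elim (simp add: i poly_pcompose algebra_simps)
  then show "\<exists>P. \<forall>\<^sub>F k in sequentially. f (T * S * k + i) = poly P (int k)" by blast
qed

text \<open>The main reduction: each class modulo \<open>T\<close> may be treated alone, with a
  period of its own. The product of these periods serves all classes.\<close>

lemma quasi_poly_residues:
  assumes "T > 0" and "\<And>i. i < T \<Longrightarrow> quasi_poly (\<lambda>k. f (T * k + i))"
  shows "quasi_poly f"
proof -
  have "\<exists>S>0. poly_residues S (\<lambda>k. f (T * k + i))" if "i < T" for i
    using assms(2)[OF that] by (simp add: quasi_poly_iff)
  then obtain S where S: "\<And>i. i < T \<Longrightarrow> S i > 0"
      "\<And>i. i < T \<Longrightarrow> poly_residues (S i) (\<lambda>k. f (T * k + i))"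
    by metis
  define M where "M = (\<Prod>i<T. S i)"
  have "M > 0" using S(1) by (auto simp: M_def intro!: prod_pos)
  have M: "poly_residues M (\<lambda>k. f (T * k + i))" if i: "i < T" for i
  proof -
    have "M = S i * (\<Prod>j\<in>{..<T} - {i}. S j)"
      unfolding M_def using i by (intro prod.remove) auto
    moreover have "(\<Prod>j\<in>{..<T} - {i}. S j) > 0"
      using S(1) by (auto intro!: prod_pos)
    ultimately show ?thesis using poly_residues_mult[OF S(2)[OF i]] by metis
  qed
  have "poly_residues (T * M) f"
    unfolding poly_residues_def
  proof (intro allI impI)
    fix i assume "i < T * M"
    define r j where "r = i mod T" and "j = i div T"
    have i: "i = T * j + r" and "r < T" using \<open>T > 0\<close> by (auto simp: r_def j_def)
    have "j < M" using \<open>i < T * M\<close> by (simp add: j_def less_mult_imp_div_less mult.commute)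
    with M[OF \<open>r < T\<close>] obtain P where
      "\<forall>\<^sub>F k in sequentially. f (T * (M * k + j) + r) = poly P (int k)"
      by (auto simp: poly_residues_def)
    then show "\<exists>P. \<forall>\<^sub>F k in sequentially. f (T * M * k + i) = poly P (int k)"
      by (auto simp: i algebra_simps)
  qed
  with \<open>T > 0\<close> \<open>M > 0\<close> show ?thesis
    unfolding quasi_poly_iff by (intro exI[of _ "T * M"]) auto
qed

lemma quasi_poly_common_period:
  assumes "quasi_poly f" and "quasi_poly g"
  obtains T where "T > 0" and "poly_residues T f" and "poly_residues T g"
proof -
  obtain S S' where "S > 0" "poly_residues S f" "S' > 0" "poly_residues S' g"
    using assms by (auto simp: quasi_poly_iff)
  with poly_residues_mult[of S f S'] poly_residues_mult[of S' g S] that[of "S * S'"]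
  show ?thesis by (simp add: mult.commute)
qed

lemma quasi_poly_eventually:
  assumes "quasi_poly f" and eq: "\<forall>\<^sub>F n in sequentially. g n = f n"
  shows "quasi_poly g"
proof -
  obtain T where "T > 0" "poly_residues T f"
    using assms(1) by (auto simp: quasi_poly_iff)
  have "poly_residues T g"
    unfolding poly_residues_def
  proof (intro allI impI)
    fix i assume "i < T"
    with \<open>poly_residues T f\<close> obtain P where
      "\<forall>\<^sub>F k in sequentially. f (T * k + i) = poly P (int k)"
      by (auto simp: poly_residues_def)
    with eventually_residue[OF eq \<open>T > 0\<close>, of i]
    have "\<forall>\<^sub>F k in sequentially. g (T * k + i) = poly P (int k)"
      by eventually_elim simp
    then show "\<exists>P. \<forall>\<^sub>F k in sequentially. g (T * k + i) = poly P (int k)" by blast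
  qed
  with \<open>T > 0\<close> show ?thesis by (auto simp: quasi_poly_iff)
qed

lemma quasi_poly_poly: "quasi_poly (\<lambda>n. poly P (int n))"
  unfolding quasi_poly_iff poly_residues_def by (intro exI[of _ 1]) (auto intro: exI[of _ P])

lemma quasi_poly_const: "quasi_poly (\<lambda>n. c)"
  using quasi_poly_poly[of "[:c:]"] by simp

lemma quasi_poly_add:
  assumes "quasi_poly f" and "quasi_poly g"
  shows "quasi_poly (\<lambda>n. f n + g n)"
proof -
  obtain T where T: "T > 0" "poly_residues T f" "poly_residues T g"
    using assms by (rule quasi_poly_common_period)
  show ?thesis
  proof (rule quasi_poly_residues[OF \<open>T > 0\<close>])
    fix i assume "i < T"
    obtain P where P: "\<forall>\<^sub>F k in sequentially. f (T * k + i) = poly P (int k)"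
      using T(2) \<open>i < T\<close> by (rule poly_residuesE)
    obtain Q where Q: "\<forall>\<^sub>F k in sequentially. g (T * k + i) = poly Q (int k)"
      using T(3) \<open>i < T\<close> by (rule poly_residuesE)
    from P Q have "\<forall>\<^sub>F k in sequentially. f (T * k + i) + g (T * k + i) = poly (P + Q) (int k)"
      by eventually_elim simp
    then show "quasi_poly (\<lambda>k. f (T * k + i) + g (T * k + i))"
      by (rule quasi_poly_eventually[OF quasi_poly_poly])
  qed
qed

lemma quasi_poly_mult:
  assumes "quasi_poly f" and "quasi_poly g"
  shows "quasi_poly (\<lambda>n. f n * g n)"
proof -
  obtain T where T: "T > 0" "poly_residues T f" "poly_residues T g"
    using assms by (rule quasi_poly_common_period)
  show ?thesis
  proof (rule quasi_poly_residues[OF \<open>T > 0\<close>])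
    fix i assume "i < T"
    obtain P where P: "\<forall>\<^sub>F k in sequentially. f (T * k + i) = poly P (int k)"
      using T(2) \<open>i < T\<close> by (rule poly_residuesE)
    obtain Q where Q: "\<forall>\<^sub>F k in sequentially. g (T * k + i) = poly Q (int k)"
      using T(3) \<open>i < T\<close> by (rule poly_residuesE)
    from P Q have "\<forall>\<^sub>F k in sequentially. f (T * k + i) * g (T * k + i) = poly (P * Q) (int k)"
      by eventually_elim simp
    then show "quasi_poly (\<lambda>k. f (T * k + i) * g (T * k + i))"
      by (rule quasi_poly_eventually[OF quasi_poly_poly])
  qed
qed

section \<open>Leading coefficients and signs at large arguments\<close>

text \<open>Induction along Horner's scheme: a positive integer value of \<open>P\<close> is at
  least 1, so \<open>k * P(k) \<ge> k\<close> eventually outweighs the constant term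
  \<open>a\<close>.\<close>

lemma eventually_poly_pos:
  fixes P :: "int poly"
  assumes "lead_coeff P > 0"
  shows "\<forall>\<^sub>F k in sequentially. poly P (int k) > 0"
  using assms
proof (induction P)
  case 0
  then show ?case by simp
next
  case (pCons a P)
  show ?case
  proof (cases "P = 0")
    case True
    with pCons.prems show ?thesis by simp
  next
    case False
    with pCons have "\<forall>\<^sub>F k in sequentially. poly P (int k) > 0" by simp
    with eventually_gt_at_top[of "nat \<bar>a\<bar>"] show ?thesis
    proof eventually_elim
      case (elim k)
      have "int k * 1 \<le> int k * poly P (int k)" using elim by (intro mult_left_mono) auto
      moreover have "\<bar>a\<bar> < int k" using elim by linarith
      ultimately have "a + int k * poly P (int k) > 0" by linarith
      then show ?case by simp
    qed
  qed
qed

lemma lead_coeff_pos_if_eventually_pos: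
  fixes P :: "int poly"
  assumes "\<forall>\<^sub>F k in sequentially. poly P (int k) > 0"
  shows "lead_coeff P > 0"
proof (rule ccontr)
  assume "\<not> lead_coeff P > 0"
  then consider "P = 0" | "lead_coeff (- P) > 0" by force
  then have "\<forall>\<^sub>F k in sequentially. poly P (int k) \<le> 0"
  proof cases
    case 2
    from eventually_poly_pos[OF 2] show ?thesis by eventually_elim simp
  qed simp
  with assms have "\<forall>\<^sub>F k in sequentially. False" by eventually_elim simp
  then show False by simp
qed

lemma qp_pos_eventually_pos:
  assumes "qp_pos f"
  shows "\<forall>\<^sub>F n in sequentially. f n > 0"
proof -
  obtain T C F where "T > 0" and
      rep: "\<And>k i. i < T \<Longrightarrow> T * k + i > C \<Longrightarrow> f (T * k + i) = poly (F i) (int k)" and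
      pos: "\<And>i. i < T \<Longrightarrow> lead_coeff (F i) > 0"
    using assms by (auto simp: qp_pos_def qp_rep_def)
  show ?thesis
  proof (rule eventually_residues[OF \<open>T > 0\<close>])
    fix i assume i: "i < T"
    show "\<forall>\<^sub>F k in sequentially. f (T * k + i) > 0"
      using eventually_residue[OF eventually_gt_at_top[of C] \<open>T > 0\<close>, of i]
        eventually_poly_pos[OF pos[OF i]]
      by eventually_elim (simp add: rep i)
  qed
qed

section \<open>Floors of quotients\<close>

text \<open>The congruence of \<open>P(N x + i)\<close> and \<open>P(i)\<close> modulo
  \<open>N\<close>, with a quotient that is itself an integer polynomial in
  \<open>x\<close>.\<close>

lemma pcompose_linear_cong:
  fixes P :: "int poly"
  shows "\<exists>Q. pcompose P [:i, N:] = [:poly P i:] + smult N Q"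
proof (induction P)
  case 0
  show ?case by (intro exI[of _ 0]) simp
next
  case (pCons a P)
  then obtain Q where Q: "pcompose P [:i, N:] = [:poly P i:] + smult N Q" by blast
  show ?case
    by (intro exI[of _ "smult i Q + [:0, poly P i:] + pCons 0 (smult N Q)"])
      (simp add: pcompose_pCons Q algebra_simps smult_add_right)
qed

lemma poly_residue_cong:
  fixes P :: "int poly"
  obtains Q where "\<And>x. poly P (N * x + i) = poly P i + N * poly Q x"
proof -
  obtain Q where Q: "pcompose P [:i, N:] = [:poly P i:] + smult N Q"
    using pcompose_linear_cong by blast
  have "poly P (N * x + i) = poly P i + N * poly Q x" for x
    using arg_cong[OF Q, of "\<lambda>p. poly p x"] by (simp add: poly_pcompose algebra_simps)
  then show ?thesis by (rule that)
qed

text \<open>On a class modulo \<open>c\<close> the numerator is a constant plus \<open>c\<close>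
  times an integer polynomial, which leaves the floor intact.\<close>

lemma quasi_poly_poly_div_const:
  fixes P :: "int poly"
  assumes "c > 0"
  shows "quasi_poly (\<lambda>n. poly P (int n) div c)"
proof (rule quasi_poly_residues[of "nat c"])
  fix i assume "i < nat c"
  obtain Q where Q: "\<And>x. poly P (c * x + int i) = poly P (int i) + c * poly Q x"
    using poly_residue_cong[of P c "int i"] by blast
  have "(\<lambda>k. poly P (int (nat c * k + i)) div c) = (\<lambda>k. poly Q (int k) + poly P (int i) div c)"
    using Q assms by (simp add: fun_eq_iff)
  then show "quasi_poly (\<lambda>k. poly P (int (nat c * k + i)) div c)"
    by (simp add: quasi_poly_add quasi_poly_poly quasi_poly_const)
qed (use assms in simp)

lemma pseudo_division:
  fixes F G :: "int poly"
  assumes "G \<noteq> 0"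
  obtains c q r where "c > 0" and "smult c F = G * q + r" and "r = 0 \<or> degree r < degree G"
proof -
  from pseudo_mod[OF assms, of F] obtain a q where aq: "a \<noteq> 0"
      "smult a F = G * q + pseudo_mod F G"
      "pseudo_mod F G = 0 \<or> degree (pseudo_mod F G) < degree G"
    by blast
  \<comment> \<open>The multiplier from \<open>pseudo_mod\<close> may be negative; its sign is moved
    into quotient and remainder.\<close>
  let ?s = "sgn a"
  have "smult (?s * a) F = G * smult ?s q + smult ?s (pseudo_mod F G)"
    using arg_cong[OF aq(2), of "smult ?s"] by (simp add: smult_add_right)
  moreover have "?s * a > 0" using aq(1) by (simp add: sgn_if)
  moreover have "smult ?s (pseudo_mod F G) = 0 \<or> degree (smult ?s (pseudo_mod F G)) < degree G"
    using aq(3) by auto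
  ultimately show ?thesis using that by blast
qed

text \<open>Eventually \<open>r\<close> is smaller than \<open>G\<close> in absolute value, so the
  floor is 0 or -1 according to the sign of \<open>r\<close>.\<close>

lemma eventually_poly_div_const:
  fixes r G :: "int poly"
  assumes "lead_coeff G > 0" and "r = 0 \<or> degree r < degree G"
  obtains e where "\<forall>\<^sub>F k in sequentially. poly r (int k) div poly G (int k) = e"
proof -
  have pos: "\<forall>\<^sub>F k in sequentially. poly G (int k) > 0"
    using assms(1) by (rule eventually_poly_pos)
  consider "r = 0" | "lead_coeff r > 0" "degree r < degree G" |
      "lead_coeff (- r) > 0" "degree r < degree G"
    using assms(2) by (cases "lead_coeff r" "0::int" rule: linorder_cases) auto
  then show ?thesis
  proof cases
    case 1
    then show ?thesis by (intro that[of 0]) simp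
  next
    case 2
    then have "lead_coeff (G - r) > 0"
      using assms(1) lead_coeff_add_le[of "- r" G] by simp
    from eventually_poly_pos[OF this] eventually_poly_pos[OF 2(1)] pos
    have "\<forall>\<^sub>F k in sequentially. poly r (int k) div poly G (int k) = 0"
      by eventually_elim simp
    then show ?thesis by (rule that)
  next
    case 3
    then have "lead_coeff (G + r) > 0"
      using assms(1) lead_coeff_add_le[of r G] by (simp add: add.commute)
    from eventually_poly_pos[OF this] eventually_poly_pos[OF 3(1)] pos
    have "\<forall>\<^sub>F k in sequentially. poly r (int k) div poly G (int k) = -1"
    proof eventually_elim
      case (elim k)
      \<comment> \<open>Here \<open>r = -1 * G + (r + G)\<close> with
        \<open>0 \<le> r + G < G\<close> at \<open>k\<close>.\<close>
      then show ?case
        by (intro int_div_pos_eq[of _ _ _ "poly r (int k) + poly G (int k)"]) auto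
    qed
    then show ?thesis by (rule that)
  qed
qed

text \<open>From \<open>c F = G q + r\<close>, nesting floors gives
  \<open>F div G = (q + r div G) div c\<close>, where \<open>r div G\<close> is eventually constant.
  Only the division by the constant \<open>c\<close> remains.\<close>

lemma quasi_poly_poly_div:
  fixes F G :: "int poly"
  assumes "lead_coeff G > 0"
  shows "quasi_poly (\<lambda>n. poly F (int n) div poly G (int n))"
proof -
  have "G \<noteq> 0" using assms by auto
  then obtain c q r where "c > 0" and eq: "smult c F = G * q + r"
      and deg: "r = 0 \<or> degree r < degree G"
    by (rule pseudo_division)
  obtain e where e: "\<forall>\<^sub>F k in sequentially. poly r (int k) div poly G (int k) = e"
    using eventually_poly_div_const[OF assms deg] .
  have "\<forall>\<^sub>F k in sequentially.
      poly F (int k) div poly G (int k) = poly (q + [:e:]) (int k) div c"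
    using e eventually_poly_pos[OF assms]
  proof eventually_elim
    case (elim k)
    let ?F = "poly F (int k)" and ?G = "poly G (int k)"
    have cF: "c * ?F = ?G * poly q (int k) + poly r (int k)"
      using arg_cong[OF eq, of "\<lambda>p. poly p (int k)"] by simp
    have "?F div ?G = (c * ?F) div (?G * c)"
      using \<open>c > 0\<close> by (simp add: mult.commute)
    also have "\<dots> = (c * ?F) div ?G div c"
      using \<open>c > 0\<close> by (simp add: zdiv_zmult2_eq)
    also have "(c * ?F) div ?G = poly q (int k) + e"
      unfolding cF using elim by simp
    finally show ?case by simp
  qed
  then show ?thesis by (rule quasi_poly_eventually[OF quasi_poly_poly_div_const[OF \<open>c > 0\<close>]])
qed

lemma quasi_poly_div:
  assumes "quasi_poly f" and "quasi_poly g" and pos: "\<forall>\<^sub>F n in sequentially. g n > 0"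
  shows "quasi_poly (\<lambda>n. f n div g n)"
proof -
  obtain T where T: "T > 0" "poly_residues T f" "poly_residues T g"
    using assms(1,2) by (rule quasi_poly_common_period)
  show ?thesis
  proof (rule quasi_poly_residues[OF \<open>T > 0\<close>])
    fix i assume "i < T"
    obtain P where P: "\<forall>\<^sub>F k in sequentially. f (T * k + i) = poly P (int k)"
      using T(2) \<open>i < T\<close> by (rule poly_residuesE)
    obtain Q where Q: "\<forall>\<^sub>F k in sequentially. g (T * k + i) = poly Q (int k)"
      using T(3) \<open>i < T\<close> by (rule poly_residuesE)
    \<comment> \<open>The sign of \<open>Q\<close> is recovered from the values of
      \<open>g\<close>.\<close>
    have "\<forall>\<^sub>F k in sequentially. poly Q (int k) > 0"
      using eventually_residue[OF pos \<open>T > 0\<close>, of i] Q by eventually_elim simp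
    then have lc: "lead_coeff Q > 0" by (rule lead_coeff_pos_if_eventually_pos)
    from P Q have "\<forall>\<^sub>F k in sequentially.
        f (T * k + i) div g (T * k + i) = poly P (int k) div poly Q (int k)"
      by eventually_elim simp
    then show "quasi_poly (\<lambda>k. f (T * k + i) div g (T * k + i))"
      by (rule quasi_poly_eventually[OF quasi_poly_poly_div[OF lc]])
  qed
qed

section \<open>Bezout identities for polynomials and quasi-polynomials\<close>

text \<open>A nonzero element \<open>p\<close> of minimal degree in the ideal \<open>(F, G)\<close> divides integer multiples
  of \<open>F\<close> and \<open>G\<close> by pseudo-division, hence an integer multiple of \<open>gcd F G = 1\<close>.\<close>

lemma coprime_int_poly_bezout_const:
  fixes F G :: "int poly"
  assumes "coprime F G"
  obtains A B N where "N > 0" and "A * F + B * G = [:N:]"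
proof -
  define I where "I = {p. p \<noteq> 0 \<and> (\<exists>A B. p = A * F + B * G)}"
  have "F \<in> I \<or> G \<in> I"
  proof -
    have "F \<noteq> 0 \<or> G \<noteq> 0" using assms by auto
    moreover have "F = 1 * F + 0 * G" "G = 0 * F + 1 * G" by simp_all
    ultimately show ?thesis unfolding I_def by blast
  qed
  then obtain p where "p \<in> I" and min: "\<And>q. q \<in> I \<Longrightarrow> degree p \<le> degree q"
    using ex_has_least_nat[of "\<lambda>p. p \<in> I" _ degree] by blast
  then obtain A B where p: "p = A * F + B * G" and "p \<noteq> 0" by (auto simp: I_def)
  have dvd: "\<exists>c>0. p dvd smult c H" if H: "H = A' * F + B' * G" for H A' B'
  proof -
    obtain c q r where "c > 0" and eq: "smult c H = p * q + r"
        and r: "r = 0 \<or> degree r < degree p"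
      using pseudo_division[OF \<open>p \<noteq> 0\<close>] by blast
    have "r = smult c H - p * q" using eq by simp
    also have "\<dots> = (smult c A' - A * q) * F + (smult c B' - B * q) * G"
      by (simp add: H p algebra_simps smult_add_right)
    finally have "r = 0" using r min[of r] unfolding I_def by force
    with eq \<open>c > 0\<close> show ?thesis by auto
  qed
  obtain c d where "c > 0" "p dvd smult c F" "d > 0" "p dvd smult d G"
    using dvd[of F 1 0] dvd[of G 0 1] by auto
  then have "p dvd smult d (smult c F)" "p dvd smult c (smult d G)"
    by (blast intro: dvd_smult)+
  \<comment> \<open>A common multiplier lets the coprimality of \<open>F\<close> and
    \<open>G\<close> leave only the constant \<open>c * d\<close>, so \<open>p\<close> is
    constant.\<close>
  then have "p dvd [:c * d:] * F" "p dvd [:c * d:] * G"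
    by (simp_all add: mult.commute)
  then have "p dvd gcd ([:c * d:] * F) ([:c * d:] * G)" by (rule gcd_greatest)
  also have "\<dots> = normalize [:c * d:]"
    by (simp only: gcd_mult_left coprime_imp_gcd_eq_1[OF assms] mult_1_right)
  finally have "p dvd [:c * d:]" by simp
  moreover have "[:c * d:] \<noteq> 0" using \<open>c > 0\<close> \<open>d > 0\<close> by simp
  ultimately have "degree p \<le> degree [:c * d:]" by (rule dvd_imp_degree_le)
  then have "degree p = 0" by simp
  then obtain N where N: "p = [:N:]" by (rule degree_eq_zeroE)
  show ?thesis
  proof (cases "N > 0")
    case True
    then show ?thesis using that[of N A B] p N by simp
  next
    case False
    with N \<open>p \<noteq> 0\<close> have "- N > 0" by (cases "N = 0") auto
    moreover have "(- A) * F + (- B) * G = - p" by (simp add: p)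
    ultimately show ?thesis by (intro that[of "- N" "- A" "- B"]) (simp_all add: N)
  qed
qed

text \<open>For large \<open>n\<close>, \<open>d n\<close> is the gcd of \<open>f n\<close> and
  \<open>g n\<close> up to sign. Leaving the sign free and ignoring small \<open>n\<close> permits
  gluing over residue classes.\<close>

definition has_bezout :: "(nat \<Rightarrow> int) \<Rightarrow> (nat \<Rightarrow> int) \<Rightarrow> bool" where
  "has_bezout f g \<longleftrightarrow> (\<exists>u v d. quasi_poly u \<and> quasi_poly v \<and> quasi_poly d \<and>
     (\<forall>\<^sub>F n in sequentially. f n * u n + g n * v n = d n \<and> d n dvd f n \<and> d n dvd g n))"

lemma has_bezoutI:
  assumes "quasi_poly u" and "quasi_poly v" and "quasi_poly d"
    and "\<forall>\<^sub>F n in sequentially. f n * u n + g n * v n = d n \<and> d n dvd f n \<and> d n dvd g n"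
  shows "has_bezout f g"
  using assms unfolding has_bezout_def by blast

lemma has_bezout_residues:
  assumes "T > 0" and "\<And>i. i < T \<Longrightarrow> has_bezout (\<lambda>k. f (T * k + i)) (\<lambda>k. g (T * k + i))"
  shows "has_bezout f g"
proof -
  define R where "R i u v d \<longleftrightarrow> quasi_poly u \<and> quasi_poly v \<and> quasi_poly d \<and>
    (\<forall>\<^sub>F k in sequentially. f (T * k + i) * u k + g (T * k + i) * v k = d k \<and>
      d k dvd f (T * k + i) \<and> d k dvd g (T * k + i))" for i u v d
  have "\<forall>i\<in>{..<T}. \<exists>u v d. R i u v d"
    using assms(2) by (simp add: has_bezout_def R_def)
  then obtain u v d where R: "\<And>i. i < T \<Longrightarrow> R i (u i) (v i) (d i)"
    by (metis lessThan_iff)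
  \<comment> \<open>Interleaving: \<open>n mod T\<close> selects the class and
    \<open>n div T\<close> is the argument within it.\<close>
  define glue where "glue w = (\<lambda>n. w (n mod T) (n div T))" for w :: "nat \<Rightarrow> nat \<Rightarrow> int"
  have glue: "glue w (T * k + i) = w i k" if "i < T" for w k i
    using that by (simp add: glue_def)
  have "quasi_poly (glue w)" if "\<And>i. i < T \<Longrightarrow> quasi_poly (w i)" for w
    using assms(1) by (rule quasi_poly_residues) (simp add: glue that)
  then have "quasi_poly (glue u)" "quasi_poly (glue v)" "quasi_poly (glue d)"
    using R by (auto simp: R_def)
  moreover have "\<forall>\<^sub>F n in sequentially. f n * glue u n + g n * glue v n = glue d n \<and>
      glue d n dvd f n \<and> glue d n dvd g n"
    using assms(1) by (rule eventually_residues) (use R in \<open>simp add: glue R_def\<close>)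
  ultimately show ?thesis unfolding has_bezout_def by blast
qed

lemma has_bezout_eventually:
  assumes "has_bezout f g" and "\<forall>\<^sub>F n in sequentially. f' n = f n"
    and "\<forall>\<^sub>F n in sequentially. g' n = g n"
  shows "has_bezout f' g'"
proof -
  obtain u v d where uvd: "quasi_poly u" "quasi_poly v" "quasi_poly d" and
    ev: "\<forall>\<^sub>F n in sequentially. f n * u n + g n * v n = d n \<and> d n dvd f n \<and> d n dvd g n"
    using assms(1) unfolding has_bezout_def by blast
  from ev assms(2,3)
  have "\<forall>\<^sub>F n in sequentially. f' n * u n + g' n * v n = d n \<and> d n dvd f' n \<and> d n dvd g' n"
    by eventually_elim simp
  with uvd show ?thesis by (rule has_bezoutI)
qed

lemma has_bezout_mult:
  assumes "has_bezout f g" and "quasi_poly h"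
  shows "has_bezout (\<lambda>n. h n * f n) (\<lambda>n. h n * g n)"
proof -
  obtain u v d where uvd: "quasi_poly u" "quasi_poly v" "quasi_poly d" and
    ev: "\<forall>\<^sub>F n in sequentially. f n * u n + g n * v n = d n \<and> d n dvd f n \<and> d n dvd g n"
    using assms(1) unfolding has_bezout_def by blast
  from ev have "\<forall>\<^sub>F n in sequentially. h n * f n * u n + h n * g n * v n = h n * d n \<and>
      h n * d n dvd h n * f n \<and> h n * d n dvd h n * g n"
  proof eventually_elim
    case (elim n)
    have "h n * f n * u n + h n * g n * v n = h n * (f n * u n + g n * v n)"
      by (simp add: algebra_simps)
    with elim show ?case by simp
  qed
  moreover have "quasi_poly (\<lambda>n. h n * d n)" using assms(2) uvd(3) by (rule quasi_poly_mult)
  ultimately show ?thesis using uvd unfolding has_bezout_def by blast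
qed

lemma int_bezout3:
  fixes x y z :: int
  obtains a b c where "a * x + b * y + c * z = gcd (gcd x y) z"
proof -
  obtain p q where pq: "p * x + q * y = gcd x y" using bezout_int by blast
  obtain r s where rs: "r * gcd x y + s * z = gcd (gcd x y) z" using bezout_int by blast
  have "(r * p) * x + (r * q) * y + s * z = gcd (gcd x y) z"
  proof -
    have "(r * p) * x + (r * q) * y + s * z = r * (p * x + q * y) + s * z"
      by (simp add: algebra_simps)
    then show ?thesis by (simp only: pq rs)
  qed
  then show ?thesis by (rule that)
qed

text \<open>If \<open>A F + B G = N\<close>, then \<open>gcd (F n) (G n)\<close> divides \<open>N\<close> and depends only on \<open>n\<close> modulo
  \<open>N\<close>; on a residue class a Bezout identity modulo \<open>N\<close> for the constants is corrected to an
  exact one by a multiple of \<open>A F + B G\<close>.\<close>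

lemma has_bezout_coprime_poly:
  fixes F G :: "int poly"
  assumes "coprime F G"
  shows "has_bezout (\<lambda>n. poly F (int n)) (\<lambda>n. poly G (int n))"
proof -
  obtain A B N where "N > 0" and AB: "A * F + B * G = [:N:]"
    using assms by (rule coprime_int_poly_bezout_const)
  show ?thesis
  proof (rule has_bezout_residues[of "nat N"])
    fix i assume "i < nat N"
    let ?x = "\<lambda>k. N * int k + int i"
    obtain P where P: "\<And>x. poly F (N * x + int i) = poly F (int i) + N * poly P x"
      using poly_residue_cong by blast
    obtain Q where Q: "\<And>x. poly G (N * x + int i) = poly G (int i) + N * poly Q x"
      using poly_residue_cong by blast
    \<comment> \<open>Including \<open>N\<close> in the gcd ensures that \<open>g\<close> divides
      the values of \<open>F\<close> and \<open>G\<close> on the whole class modulo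
      \<open>N\<close>.\<close>
    define g where "g = gcd (gcd (poly F (int i)) (poly G (int i))) N"
    obtain a b c where abc: "a * poly F (int i) + b * poly G (int i) + c * N = g"
      unfolding g_def by (rule int_bezout3)
    \<comment> \<open>\<open>S\<close> is the error quotient: on the class,
      \<open>a F + b G = g + N S\<close>. Since \<open>N = A F + B G\<close>, subtracting
      \<open>S A\<close> from \<open>a\<close> and \<open>S B\<close> from \<open>b\<close> removes
      the error.\<close>
    define S where "S = smult a P + smult b Q - [:c:]"
    define U where "U = [:a:] - S * pcompose A [:int i, N:]"
    define V where "V = [:b:] - S * pcompose B [:int i, N:]"
    have "poly F (?x k) * poly U (int k) + poly G (?x k) * poly V (int k) = g" for k
    proof -
      let ?F = "poly F (?x k)" and ?G = "poly G (?x k)" and ?S = "poly S (int k)"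
      have N: "poly A (?x k) * ?F + poly B (?x k) * ?G = N"
        using arg_cong[OF AB, of "\<lambda>p. poly p (?x k)"] by simp
      have "a * ?F + b * ?G = g + N * ?S"
        unfolding P Q by (simp add: S_def abc [symmetric] algebra_simps)
      moreover have "?F * poly U (int k) + ?G * poly V (int k) =
          a * ?F + b * ?G - ?S * (poly A (?x k) * ?F + poly B (?x k) * ?G)"
        by (simp add: U_def V_def poly_pcompose algebra_simps)
      ultimately show ?thesis unfolding N by simp
    qed
    moreover have "g dvd poly F (?x k)" "g dvd poly G (?x k)" for k
    proof -
      have "g dvd poly F (int i)" "g dvd poly G (int i)" "g dvd N"
        unfolding g_def by (auto intro: dvd_trans[OF gcd_dvd1])
      then show "g dvd poly F (?x k)" "g dvd poly G (?x k)" by (simp_all add: P Q)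
    qed
    moreover have "int (nat N * k + i) = ?x k" for k using \<open>N > 0\<close> by simp
    ultimately show "has_bezout (\<lambda>k. poly F (int (nat N * k + i))) (\<lambda>k. poly G (int (nat N * k + i)))"
      using \<open>N > 0\<close>
      by (intro has_bezoutI[OF quasi_poly_poly[of U] quasi_poly_poly[of V] quasi_poly_const[of g]])
        simp
  qed (use \<open>N > 0\<close> in simp)
qed

text \<open>Integer polynomials have gcds but not always Bezout identities. The gcd is divided out,
  the coprime cofactors are handled pointwise, and the gcd is multiplied back.\<close>

lemma has_bezout_poly: "has_bezout (\<lambda>n. poly F (int n)) (\<lambda>n. poly G (int n))"
proof (cases "F = 0 \<and> G = 0")
  case True
  then show ?thesis
    unfolding has_bezout_def
    by (intro exI[of _ "\<lambda>_. 0"]) (auto simp: quasi_poly_const)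
next
  case False
  then obtain F' G' where "F = gcd F G * F'" "G = gcd F G * G'" "coprime F' G'"
    using gcd_coprime_exists[of F G] by (auto simp: mult.commute)
  then show ?thesis
    using has_bezout_mult[OF has_bezout_coprime_poly[of F' G'] quasi_poly_poly[of "gcd F G"]]
    by (metis (no_types, lifting) ext poly_mult)
qed

lemma quasi_poly_has_bezout:
  assumes "quasi_poly f" and "quasi_poly g"
  shows "has_bezout f g"
proof -
  obtain T where T: "T > 0" "poly_residues T f" "poly_residues T g"
    using assms by (rule quasi_poly_common_period)
  show ?thesis
  proof (rule has_bezout_residues[OF \<open>T > 0\<close>])
    fix i assume "i < T"
    obtain P where P: "\<forall>\<^sub>F k in sequentially. f (T * k + i) = poly P (int k)"
      using T(2) \<open>i < T\<close> by (rule poly_residuesE)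
    obtain Q where Q: "\<forall>\<^sub>F k in sequentially. g (T * k + i) = poly Q (int k)"
      using T(3) \<open>i < T\<close> by (rule poly_residuesE)
    from P Q show "has_bezout (\<lambda>k. f (T * k + i)) (\<lambda>k. g (T * k + i))"
      by (rule has_bezout_eventually[OF has_bezout_poly])
  qed
qed

section \<open>From trivial ggcd to a Bezout identity at every argument\<close>

text \<open>The eventual gcd \<open>d\<close> is extended to a nowhere zero common divisor
  \<open>p\<close>. As 1 is a greatest common divisor, \<open>p\<close> divides 1 everywhere; below
  the threshold, integer Bezout identities fill in.\<close>

lemma ggcd_1_bezout:
  assumes "quasi_poly f" and "quasi_poly g" and nz: "\<forall>\<^sub>F n in sequentially. f n \<noteq> 0"
    and ggcd: "is_ggcd (\<lambda>n. 1) {f, g}"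
  obtains u v where "quasi_poly u" and "quasi_poly v" and "\<And>n. f n * u n + g n * v n = 1"
proof -
  obtain u v d where uvd: "quasi_poly u" "quasi_poly v" "quasi_poly d" and
    ev: "\<forall>\<^sub>F n in sequentially. f n * u n + g n * v n = d n \<and> d n dvd f n \<and> d n dvd g n"
    using quasi_poly_has_bezout[OF assms(1,2)] unfolding has_bezout_def by blast
  from eventually_conj[OF ev nz] obtain K where K: "\<And>n. n \<ge> K \<Longrightarrow> f n * u n + g n * v n = d n"
      "\<And>n. n \<ge> K \<Longrightarrow> d n dvd f n" "\<And>n. n \<ge> K \<Longrightarrow> d n dvd g n" "\<And>n. n \<ge> K \<Longrightarrow> f n \<noteq> 0"
    unfolding eventually_sequentially by blast
  \<comment> \<open>Where \<open>f\<close> and \<open>g\<close> both vanish, any value other than 0, 1, -1 shows that 1 is not a gcd.\<close>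
  define p where "p n = (if n \<ge> K then d n else if gcd (f n) (g n) = 0 then 2
    else gcd (f n) (g n))" for n
  have "quasi_poly p"
    using \<open>quasi_poly d\<close>
    by (rule quasi_poly_eventually)
      (use eventually_ge_at_top[of K] in eventually_elim, simp add: p_def)
  moreover have "p n \<noteq> 0" for n using K(2)[of n] K(4)[of n] by (auto simp: p_def)
  moreover have "p n dvd f n" "p n dvd g n" for n using K(2,3)[of n] by (auto simp: p_def)
  ultimately have "qp_dvd p (\<lambda>n. 1)"
    using ggcd assms(1,2) by (auto simp: is_ggcd_def is_qp_gcd_def qp_dvd_def)
  then have unit: "p n dvd 1" for n by (simp add: qp_dvd_def)
  have "\<exists>x y. f n * x + g n * y = 1" if "n < K" for n
  proof -
    have "gcd (f n) (g n) = 1" using unit[of n] that by (auto simp: p_def split: if_splits)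
    then show ?thesis using bezout_int[of "f n" "g n"] by (metis mult.commute)
  qed
  then obtain x y where xy: "\<And>n. n < K \<Longrightarrow> f n * x n + g n * y n = 1" by metis
  \<comment> \<open>For large \<open>n\<close>, \<open>d n\<close> is 1 or -1, hence its own
    inverse: multiplying the cofactors by it turns \<open>d n\<close> into 1.\<close>
  define u' where "u' n = (if n \<ge> K then u n * d n else x n)" for n
  define v' where "v' n = (if n \<ge> K then v n * d n else y n)" for n
  have "quasi_poly u'"
    by (rule quasi_poly_eventually[OF quasi_poly_mult[OF uvd(1,3)]])
      (use eventually_ge_at_top[of K] in eventually_elim, simp add: u'_def)
  moreover have "quasi_poly v'"
    by (rule quasi_poly_eventually[OF quasi_poly_mult[OF uvd(2,3)]])
      (use eventually_ge_at_top[of K] in eventually_elim, simp add: v'_def)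
  moreover have "f n * u' n + g n * v' n = 1" for n
  proof (cases "n \<ge> K")
    case True
    then have "d n dvd 1" using unit[of n] by (simp add: p_def)
    then have "d n * d n = 1" by (auto simp: zdvd1_eq abs_if split: if_splits)
    moreover have "f n * u' n + g n * v' n = (f n * u n + g n * v n) * d n"
      using True by (simp add: u'_def v'_def algebra_simps)
    ultimately show ?thesis using K(1)[OF True] by simp
  next
    case False
    then show ?thesis using xy by (simp add: u'_def v'_def)
  qed
  ultimately show ?thesis by (rule that)
qed

section \<open>Counting the representations\<close>

text \<open>With \<open>x\<^sub>0 = u m mod b\<close> and \<open>y\<^sub>0 = w m mod a\<close>, the solutions are \<open>(x\<^sub>0 + b t, y\<^sub>0 + a (s - t))\<close>
  for \<open>0 \<le> t \<le> s\<close>; the range is empty if \<open>s = -1\<close>.\<close>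

lemma num_reps_eq:
  fixes a b m :: int
  assumes "a > 0" and "b > 0" and "m \<ge> 0"
    and u: "a * u + b * v = 1" and w: "b * w + a * z = 1"
  obtains s where "m = (u * m mod b) * a + (w * m mod a) * b + a * b * s"
    and "int (num_reps a b m) = s + 1"
proof -
  define x0 where "x0 = u * m mod b"
  define y0 where "y0 = w * m mod a"
  have x0: "0 \<le> x0" "x0 < b" and y0: "0 \<le> y0" "y0 < a"
    using assms by (simp_all add: x0_def y0_def)
  have cop: "coprime a b"
    by (rule coprimeI) (metis u dvd_add dvd_mult2)
  have "b dvd m - x0 * a"
  proof -
    have "b dvd u * m - x0" by (simp add: x0_def minus_mod_eq_mult_div)
    moreover have "m - x0 * a = (u * m - x0) * a + b * (v * m)"
      using arg_cong[OF u, of "\<lambda>t. t * m"] by (simp add: algebra_simps)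
    ultimately show ?thesis by simp
  qed
  then have b: "b dvd m - x0 * a - y0 * b" by simp
  have "a dvd m - y0 * b"
  proof -
    have "a dvd w * m - y0" by (simp add: y0_def minus_mod_eq_mult_div)
    moreover have "m - y0 * b = (w * m - y0) * b + a * (z * m)"
      using arg_cong[OF w, of "\<lambda>t. t * m"] by (simp add: algebra_simps)
    ultimately show ?thesis by simp
  qed
  then have "a dvd m - y0 * b - x0 * a" by simp
  with b have "a * b dvd m - x0 * a - y0 * b"
    using cop by (intro divides_mult) (simp_all add: algebra_simps)
  then obtain s where s: "m - x0 * a - y0 * b = a * b * s" by (elim dvdE)
  then have m: "m = x0 * a + y0 * b + a * b * s" by simp
  \<comment> \<open>Each of the two remainder terms is less than \<open>a * b\<close>, so
    \<open>s \<le> -2\<close> would make \<open>m\<close> negative.\<close>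
  have "s \<ge> -1"
  proof (rule ccontr)
    assume "\<not> s \<ge> -1"
    then have "a * b * s \<le> a * b * (-2)" using assms by (intro mult_left_mono) auto
    moreover have "x0 * a < b * a" "y0 * b < a * b" using x0 y0 assms by simp_all
    ultimately show False using m \<open>m \<ge> 0\<close> by (simp add: mult.commute)
  qed
  have "{(x, y). x \<ge> 0 \<and> y \<ge> 0 \<and> x * a + y * b = m} =
      (\<lambda>t. (x0 + b * t, y0 + a * (s - t))) ` {0..s}"
  proof (intro equalityI subsetI)
    fix p assume "p \<in> {(x, y). x \<ge> 0 \<and> y \<ge> 0 \<and> x * a + y * b = m}"
    then obtain x y where p: "p = (x, y)" "x \<ge> 0" "y \<ge> 0" and eq: "x * a + y * b = m" by auto
    have "(x - x0) * a = b * (a * s + y0 - y)" using eq m by (simp add: algebra_simps)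
    then have "b dvd (x - x0) * a" by simp
    then have "b dvd x - x0"
      using cop by (simp add: coprime_dvd_mult_left_iff coprime_commute)
    then obtain t where t: "x = x0 + b * t" by (metis add_diff_cancel_left' diff_add_cancel dvdE add.commute)
    have "b * y = b * (y0 + a * (s - t))" using eq m t by (simp add: algebra_simps)
    then have y: "y = y0 + a * (s - t)" using \<open>b > 0\<close> by simp
    \<comment> \<open>From \<open>x \<ge> 0\<close> and \<open>x0 < b\<close> follows
      \<open>t > -1\<close>, which for integers is \<open>t \<ge> 0\<close>; likewise
      \<open>s - t > -1\<close> below.\<close>
    have "b * (t + 1) > 0" using p(2) t x0 by (simp add: algebra_simps)
    then have "t \<ge> 0" using \<open>b > 0\<close> by (simp add: zero_less_mult_iff)
    have "a * (s - t + 1) > 0" using p(3) y y0 by (simp add: algebra_simps)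
    then have "t \<le> s" using \<open>a > 0\<close> by (simp add: zero_less_mult_iff)
    with \<open>t \<ge> 0\<close> t y p(1) show "p \<in> (\<lambda>t. (x0 + b * t, y0 + a * (s - t))) ` {0..s}" by auto
  next
    fix p assume "p \<in> (\<lambda>t. (x0 + b * t, y0 + a * (s - t))) ` {0..s}"
    then obtain t where t: "0 \<le> t" "t \<le> s" and p: "p = (x0 + b * t, y0 + a * (s - t))" by auto
    have "x0 + b * t \<ge> 0" "y0 + a * (s - t) \<ge> 0" using x0 y0 assms t by simp_all
    moreover have "(x0 + b * t) * a + (y0 + a * (s - t)) * b = m"
      by (simp add: m algebra_simps)
    ultimately show "p \<in> {(x, y). x \<ge> 0 \<and> y \<ge> 0 \<and> x * a + y * b = m}" by (simp add: p)
  qed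
  moreover have "inj_on (\<lambda>t. (x0 + b * t, y0 + a * (s - t))) {0..s}"
    using \<open>b > 0\<close> by (auto simp: inj_on_def)
  ultimately have "num_reps a b m = card {0..s}" by (simp add: num_reps_def card_image)
  then have "int (num_reps a b m) = s + 1" using \<open>s \<ge> -1\<close> by simp
  with m show ?thesis using that unfolding x0_def y0_def by blast
qed

text \<open>The fractional parts are the remainders over their moduli, so dividing the equation for
  \<open>m\<close> by \<open>a * b\<close> gives \<open>s\<close>. The inverses \<open>u\<close> and
  \<open>w\<close> may come from unrelated identities.\<close>

lemma num_reps_eq_frac:
  fixes a b m :: int
  assumes "a > 0" and "b > 0" and "m \<ge> 0"
    and "a * u + b * v = 1" and "b * w + a * z = 1"
  shows "(of_nat (num_reps a b m) :: rat) = of_int m / (of_int a * of_int b)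
    - frac (of_int u * of_int m / of_int b) - frac (of_int w * of_int m / of_int a) + 1"
proof -
  obtain s where s: "m = (u * m mod b) * a + (w * m mod a) * b + a * b * s"
      and count: "int (num_reps a b m) = s + 1"
    using num_reps_eq[OF assms] by blast
  have frac: "frac (of_int x / of_int e :: rat) = of_int (x mod e) / of_int e"
    if "e > 0" for x e
    using that
    by (simp add: frac_def floor_divide_of_int_eq minus_div_mult_eq_mod [symmetric] field_simps)
  have "(of_nat (num_reps a b m) :: rat) = of_int (int (num_reps a b m))" by simp
  also have "\<dots> = of_int s + 1" by (simp add: count)
  also have "of_int s = (of_int m :: rat) / (of_int a * of_int b)
      - of_int (u * m mod b) / of_int b - of_int (w * m mod a) / of_int a"
    using assms(1,2) arg_cong[OF s, of "of_int :: int \<Rightarrow> rat"] by (simp add: field_simps)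
  finally show ?thesis
    using frac[OF assms(1), of "w * m"] frac[OF assms(2), of "u * m"] by simp
qed

text \<open>With both inverses from one identity, \<open>m = u m a + v m b\<close>. Splitting
  \<open>u m\<close> and \<open>v m\<close> into quotient and remainder shows that \<open>s\<close>
  is the sum of the two quotients; this form contains only integer division.\<close>

lemma num_reps_eq_div:
  fixes a b m :: int
  assumes "a > 0" and "b > 0" and "m \<ge> 0" and uv: "a * u + b * v = 1"
  shows "int (num_reps a b m) = (u * m) div b + (v * m) div a + 1"
proof -
  have vu: "b * v + a * u = 1" using uv by simp
  define x p y q where "x = u * m mod b" "p = u * m div b" "y = v * m mod a" "q = v * m div a"
  note defs = this
  obtain s where s: "m = x * a + y * b + a * b * s" and count: "int (num_reps a b m) = s + 1"
    using num_reps_eq[OF assms vu] unfolding defs by blast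
  have "m = u * m * a + v * m * b"
    using arg_cong[OF uv, of "\<lambda>t. t * m"] by (simp add: algebra_simps)
  also have "\<dots> = (p * b + x) * a + (q * a + y) * b"
    by (simp only: defs div_mult_mod_eq)
  finally have "a * b * s = a * b * (p + q)"
    using s by (simp add: algebra_simps)
  then show ?thesis using assms(1,2) count by (simp add: defs)
qed

section \<open>Quasi-polynomiality and the formula\<close>

text \<open>Positive leading coefficients control signs only at large arguments, so the formula is
  stated where the signs are right, and this is shown to hold eventually.\<close>

theorem lemma4p1:
  fixes a1 a2 m :: "nat \<Rightarrow> int"
  assumes "quasi_poly a1" and "quasi_poly a2" and "quasi_poly m"
    and "qp_pos a1" and "qp_pos a2" and "qp_pos m"
    and "is_ggcd (\<lambda>n. 1) {a1, a2}"
  shows "quasi_poly (\<lambda>n. int (num_reps (a1 n) (a2 n) (m n))) \<and>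
    (\<exists>u1. is_qp_inverse u1 a1 a2) \<and> (\<exists>u2. is_qp_inverse u2 a2 a1) \<and>
    (\<forall>\<^sub>F n in sequentially. a1 n > 0 \<and> a2 n > 0 \<and> m n \<ge> 0) \<and>
    (\<forall>u1 u2. is_qp_inverse u1 a1 a2 \<longrightarrow> is_qp_inverse u2 a2 a1 \<longrightarrow>
      (\<forall>n. a1 n > 0 \<and> a2 n > 0 \<and> m n \<ge> 0 \<longrightarrow>
        (of_nat (num_reps (a1 n) (a2 n) (m n)) :: rat) =
          of_int (m n) / (of_int (a1 n) * of_int (a2 n))
          - frac (of_int (u1 n) * of_int (m n) / of_int (a2 n))
          - frac (of_int (u2 n) * of_int (m n) / of_int (a1 n)) + 1))"
proof (intro conjI)
  have pos1: "\<forall>\<^sub>F n in sequentially. a1 n > 0" and pos2: "\<forall>\<^sub>F n in sequentially. a2 n > 0"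
    and pos3: "\<forall>\<^sub>F n in sequentially. m n > 0"
    using assms(4-6) by (simp_all add: qp_pos_eventually_pos)
  then show ev: "\<forall>\<^sub>F n in sequentially. a1 n > 0 \<and> a2 n > 0 \<and> m n \<ge> 0"
    by eventually_elim simp
  have "\<forall>\<^sub>F n in sequentially. a1 n \<noteq> 0" using pos1 by eventually_elim simp
  then obtain u v where uv: "quasi_poly u" "quasi_poly v" "\<And>n. a1 n * u n + a2 n * v n = 1"
    using ggcd_1_bezout[OF assms(1,2) _ assms(7)] by blast
  then show "\<exists>u1. is_qp_inverse u1 a1 a2" unfolding is_qp_inverse_def by blast
  show "\<exists>u2. is_qp_inverse u2 a2 a1"
    using uv unfolding is_qp_inverse_def by (metis add.commute)
  \<comment> \<open>The count does not depend on the inverses, so the pair from a single Bezout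
    identity suffices here; arbitrary inverses enter only in the formula.\<close>
  have "quasi_poly (\<lambda>n. (u n * m n) div a2 n + (v n * m n) div a1 n + 1)"
    using assms(1-3) uv(1,2) pos1 pos2
    by (intro quasi_poly_add quasi_poly_div quasi_poly_mult quasi_poly_const)
  moreover from ev have "\<forall>\<^sub>F n in sequentially. int (num_reps (a1 n) (a2 n) (m n)) =
      (u n * m n) div a2 n + (v n * m n) div a1 n + 1"
    by eventually_elim (simp add: num_reps_eq_div uv(3))
  ultimately show "quasi_poly (\<lambda>n. int (num_reps (a1 n) (a2 n) (m n)))"
    by (rule quasi_poly_eventually)
  show "\<forall>u1 u2. is_qp_inverse u1 a1 a2 \<longrightarrow> is_qp_inverse u2 a2 a1 \<longrightarrow>
      (\<forall>n. a1 n > 0 \<and> a2 n > 0 \<and> m n \<ge> 0 \<longrightarrow>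
        (of_nat (num_reps (a1 n) (a2 n) (m n)) :: rat) =
          of_int (m n) / (of_int (a1 n) * of_int (a2 n))
          - frac (of_int (u1 n) * of_int (m n) / of_int (a2 n))
          - frac (of_int (u2 n) * of_int (m n) / of_int (a1 n)) + 1)"
    unfolding is_qp_inverse_def by (blast intro: num_reps_eq_frac)
qed

end
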